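(* Let $d=1$, $\bar f=\exp$ and $g=K-\bar f$. Then there is a $\gamma_1>0$ such that $P_t\bar f=\gamma_1^t\bar f$ for every $t\in I$; suppose that $\gamma_1\in(0,e^r]$. Assume furthermore that $y_i^{(h)}\geq 0$ for all $i\in\{1,\dots,m\}$. Then there exists a real number $D>0$ such that for all $N>M$ in $\mathbb{N}$, all $s\in(0,T]\cap(2^N\cdot I)$ and all monotonely decreasing measurable $f:\mathbb{R}\to\mathbb{R}$ with $f\geq g\vee 0$, $$\left\|(B_{s2^{-N}})^{\circ 2^N}f-(B_{s2^{-M}})^{\circ 2^M}f\right\|_{L^1(\{P_h(g\vee 0)>P_hg\})}\leq D\,s^2\,2^{-M}\left(1-2^{-(N-M)}\right)\leq D\,s^2\,2^{-M}.$$ Explicitly, these bounds hold with $$D=\left((\ln\gamma_1-r)\tilde D+rK+C_0\right)\cdot\frac{\max_{i}y_i^{(h)}}{h},$$ where $C_0$ and $\tilde D$ are the constants defined in the context.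
   Context: Setting: $d\in\mathbb{N}$, $h>0$, $I=h\mathbb{N}_0=\{0,h,2h,\dots\}$, $T\in\{2h,3h,\dots\}$, $r>0$, $K\geq 0$, $m\in\mathbb{N}$. $(P_t)_{t\in I}$ is a translation-invariant finite-state Markov chain on $\mathbb{R}^d$: there are increments $y_1^{(h)},\dots,y_m^{(h)}\in\mathbb{R}^d$ (not necessarily distinct) and weights $\alpha_1^{(h)},\dots,\alpha_m^{(h)}\in(0,1]$ with $\sum_i\alpha_i^{(h)}=1$ such that $P_hf=\sum_{i=1}^m\alpha_i^{(h)}f(\cdot+y_i^{(h)})$, $P_0=\mathrm{id}$ and $P_{nh}=(P_h)^n$. For $t\in I$ and measurable $f$, $B_tf=\max\{e^{-rt}P_tf,\,g\}$ pointwise; $(B_t)^{\circ n}$ is the $n$-fold composition. $a\vee b=\max\{a,b\}$; $2^N\cdot I=\{2^Nt:t\in I\}$. All functions are measurable; $L^1(C)$ is with respect to Lebesgue measure restricted to $C$, and norms take values in $[0,+\infty]$. For $t\in I$, $E^t=\{x:P_t(g\vee 0)(x)>P_tg(x)\}$. The constant $\tilde D$ is: $\tilde D=\inf_{\bigcup_{t\in(0,T]\cap I}E^t}\bar f$ if $\gamma_1<e^r$; $\tilde D=0$ if $\gamma_1=e^r$; $\tilde D=\sup_{\bigcup_{t\in(0,T]\cap I}E^t}\bar f$ if $\gamma_1>e^r$. The constant $C_0$ is $$C_0=K\left(\sup_{s\in(0,T]\cap I}\frac{1-e^{-rs}}{s}-r\right)+\tilde D\left(\sup_{s\in(0,T]\cap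 I}\frac{\gamma_1^se^{-rs}-1}{s}-\ln\gamma_1+r\right).$$ *)

theory Defs
  imports "HOL-Analysis.Analysis"
begin

definition time_grid :: "real \<Rightarrow> real set" where
  "time_grid h = range (\<lambda>n::nat. real n * h)"

text \<open>The chain is represented by its family of transition operators \<open>P\<close>. Only the values
  \<open>P t\<close> with \<open>t\<close> in the time grid are constrained, and only these are used below.\<close>

definition finite_state_chain ::
    "real \<Rightarrow> nat \<Rightarrow> (nat \<Rightarrow> real) \<Rightarrow> (nat \<Rightarrow> 'a) \<Rightarrow>
     (real \<Rightarrow> ('a::euclidean_space \<Rightarrow> real) \<Rightarrow> 'a \<Rightarrow> real) \<Rightarrow> bool" where
  "finite_state_chain h m \<alpha> y P \<longleftrightarrow>
     (\<forall>i\<in>{1..m}. 0 < \<alpha> i \<and> \<alpha> i \<le> 1) \<and> (\<Sum>i=1..m. \<alpha> i) = 1 \<and>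
     (\<forall>f x. P h f x = (\<Sum>i=1..m. \<alpha> i * f (x + y i))) \<and>
     P 0 = id \<and>
     (\<forall>n::nat. P (real n * h) = (P h) ^^ n)"

definition B_op ::
    "(real \<Rightarrow> ('a \<Rightarrow> real) \<Rightarrow> 'a \<Rightarrow> real) \<Rightarrow> real \<Rightarrow> ('a \<Rightarrow> real) \<Rightarrow> real \<Rightarrow>
     ('a \<Rightarrow> real) \<Rightarrow> 'a \<Rightarrow> real" where
  "B_op P r g t f = (\<lambda>x. max (exp (- r * t) * P t f x) (g x))"

definition E_set ::
    "(real \<Rightarrow> ('a \<Rightarrow> real) \<Rightarrow> 'a \<Rightarrow> real) \<Rightarrow> ('a \<Rightarrow> real) \<Rightarrow> real \<Rightarrow> 'a set" where
  "E_set P g t = {x. P t (\<lambda>z. max (g z) 0) x > P t g x}"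

text \<open>The norm takes values in \<open>[0, \<infinity>]\<close>; the type \<open>ereal\<close> is used so that it can be compared
  with a real number of any sign, without truncation at zero.\<close>

definition L1_norm_on :: "'a::euclidean_space set \<Rightarrow> ('a \<Rightarrow> real) \<Rightarrow> ereal" where
  "L1_norm_on C u = enn2ereal (\<integral>\<^sup>+x\<in>C. ennreal \<bar>u x\<bar> \<partial>lborel)"

text \<open>The infimum and supremum are those of the reals, so a branch is meaningful only when \<open>fbar\<close>
  is bounded on the union in the corresponding direction. For \<open>fbar = exp\<close> the infimum is
  always meaningful. The supremum may be infinite, but it only occurs when \<open>\<gamma> > exp r\<close>.\<close>

definition D_tilde ::
    "(real \<Rightarrow> ('a \<Rightarrow> real) \<Rightarrow> 'a \<Rightarrow> real) \<Rightarrow> real \<Rightarrow> real \<Rightarrow> real \<Rightarrow>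
     ('a \<Rightarrow> real) \<Rightarrow> ('a \<Rightarrow> real) \<Rightarrow> real \<Rightarrow> real" where
  "D_tilde P h T r g fbar \<gamma> =
     (if \<gamma> < exp r then (INF x\<in>(\<Union>t\<in>{0<..T} \<inter> time_grid h. E_set P g t). fbar x)
      else if \<gamma> = exp r then 0
      else (SUP x\<in>(\<Union>t\<in>{0<..T} \<inter> time_grid h. E_set P g t). fbar x))"

definition C_zero ::
    "(real \<Rightarrow> ('a \<Rightarrow> real) \<Rightarrow> 'a \<Rightarrow> real) \<Rightarrow> real \<Rightarrow> real \<Rightarrow> real \<Rightarrow> real \<Rightarrow>
     ('a \<Rightarrow> real) \<Rightarrow> ('a \<Rightarrow> real) \<Rightarrow> real \<Rightarrow> real" where
  "C_zero P h T r K g fbar \<gamma> =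
     K * ((SUP s\<in>{0<..T} \<inter> time_grid h. (1 - exp (- r * s)) / s) - r) +
     D_tilde P h T r g fbar \<gamma> *
       ((SUP s\<in>{0<..T} \<inter> time_grid h. (\<gamma> powr s * exp (- r * s) - 1) / s) - ln \<gamma> + r)"

text \<open>The natural numbers \<open>M < N\<close> start at 1.\<close>

definition refinement_bound ::
    "(real \<Rightarrow> (real \<Rightarrow> real) \<Rightarrow> real \<Rightarrow> real) \<Rightarrow> real \<Rightarrow> real \<Rightarrow> real \<Rightarrow>
     (real \<Rightarrow> real) \<Rightarrow> real \<Rightarrow> bool" where
  "refinement_bound P h T r g D \<longleftrightarrow>
     (\<forall>(M::nat) (N::nat) s f.
        1 \<le> M \<longrightarrow> M < N \<longrightarrow> s \<in> {0<..T} \<inter> (\<lambda>t. 2 ^ N * t) ` time_grid h \<longrightarrow>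
        f \<in> borel_measurable borel \<longrightarrow> antimono f \<longrightarrow> (\<forall>x. f x \<ge> max (g x) 0) \<longrightarrow>
          L1_norm_on (E_set P g h)
            (\<lambda>x. ((B_op P r g (s / 2 ^ N)) ^^ (2 ^ N)) f x
                 - ((B_op P r g (s / 2 ^ M)) ^^ (2 ^ M)) f x)
            \<le> ereal (D * s\<^sup>2 * (1 / 2 ^ M) * (1 - 1 / 2 ^ (N - M)))
          \<and> D * s\<^sup>2 * (1 / 2 ^ M) * (1 - 1 / 2 ^ (N - M)) \<le> D * s\<^sup>2 * (1 / 2 ^ M))"

end

theory Submission
  imports Defs
begin

text \<open>For nonnegative increments, \<open>{x..}\<close> is invariant under the chain, so bounds on \<open>{x..}\<close>
  propagate. One step of \<open>B\<close> exceeds the discounted expectation by at most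
  \<open>K (1 - e\<^sup>-\<^sup>r\<^sup>t) - e\<^sup>x (1 - \<gamma>\<^sup>t e\<^sup>-\<^sup>r\<^sup>t)\<close>, which on \<open>E\<^sup>h\<close> is at most \<open>t A\<close> with
  \<open>D = A (max y) / h\<close>. Hence every refinement lies, on \<open>E\<^sup>h\<close>, between \<open>e\<^sup>-\<^sup>r\<^sup>s P\<^sub>s f\<close> and
  \<open>e\<^sup>-\<^sup>r\<^sup>s P\<^sub>s f + s A\<close>, and equals the former where \<open>g \<le> 0\<close>. The part of \<open>E\<^sup>h\<close> where \<open>g > 0\<close> is
  contained in an interval of length \<open>max y\<close>, and \<open>s 2\<^sup>-\<^sup>M - s 2\<^sup>-\<^sup>N \<ge> h\<close> because both are distinct
  grid points; so no telescoping over the levels is needed.\<close>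

section \<open>Averaging operators that look only to the right\<close>

text \<open>Comparing only on \<open>{x..}\<close> encodes the absence of negative increments, so
  estimates valid to the right of a point survive iteration. The affine law joins scaling by a real
  of either sign with preservation of constants; the payoff \<open>K - exp x\<close> is the case
  \<open>c = -1\<close>.\<close>

definition averaging :: "((real \<Rightarrow> real) \<Rightarrow> real \<Rightarrow> real) \<Rightarrow> bool" where
  "averaging Q \<longleftrightarrow>
     (\<forall>f f' x. (\<forall>z\<ge>x. f z \<le> f' z) \<longrightarrow> Q f x \<le> Q f' x) \<and>
     (\<forall>c d f. Q (\<lambda>z. c * f z + d) = (\<lambda>x. c * Q f x + d))"

lemma averaging_mono: "averaging Q \<Longrightarrow> (\<And>z. z \<ge> x \<Longrightarrow> f z \<le> f' z) \<Longrightarrow> Q f x \<le> Q f' x"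
  unfolding averaging_def by blast

lemma averaging_affine: "averaging Q \<Longrightarrow> Q (\<lambda>z. c * f z + d) x = c * Q f x + d"
  unfolding averaging_def by metis

lemma averaging_const: "averaging Q \<Longrightarrow> Q (\<lambda>z. d) x = d"
  using averaging_affine[of Q 0 "\<lambda>z. 0" d x] by simp

lemma averaging_id: "averaging id"
  unfolding averaging_def by auto

lemma averaging_comp:
  assumes "averaging Q" "averaging R"
  shows "averaging (Q \<circ> R)"
  using assms unfolding averaging_def by (auto simp: o_def)

lemma averaging_funpow: "averaging Q \<Longrightarrow> averaging (Q ^^ n)"
  by (induction n) (simp_all add: averaging_id averaging_comp del: comp_apply)

lemma averaging_weighted_translates:
  fixes \<alpha> y :: "nat \<Rightarrow> real"
  assumes "\<And>i. i \<in> I \<Longrightarrow> 0 \<le> \<alpha> i" "\<And>i. i \<in> I \<Longrightarrow> 0 \<le> y i" "sum \<alpha> I = 1"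
  shows "averaging (\<lambda>f x. \<Sum>i\<in>I. \<alpha> i * f (x + y i))"
  unfolding averaging_def
proof (intro conjI allI impI ext)
  fix f f' :: "real \<Rightarrow> real" and x
  assume "\<forall>z\<ge>x. f z \<le> f' z"
  then show "(\<Sum>i\<in>I. \<alpha> i * f (x + y i)) \<le> (\<Sum>i\<in>I. \<alpha> i * f' (x + y i))"
    using assms by (intro sum_mono mult_left_mono) auto
next
  fix c d x :: real and f :: "real \<Rightarrow> real"
  have "(\<Sum>i\<in>I. \<alpha> i * (c * f (x + y i) + d))
      = (\<Sum>i\<in>I. c * (\<alpha> i * f (x + y i)) + d * \<alpha> i)"
    by (intro sum.cong) (auto simp: algebra_simps)
  then show "(\<Sum>i\<in>I. \<alpha> i * (c * f (x + y i) + d)) = c * (\<Sum>i\<in>I. \<alpha> i * f (x + y i)) + d"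
    using assms(3) by (simp add: sum.distrib flip: sum_distrib_left)
qed

section \<open>Iterates of the reward operator\<close>

text \<open>Dropping the payoff branch of every maximum gives the lower bound. For the upper bound,
  each step adds at most \<open>\<epsilon>\<close>, while the error accumulated so far is preserved
  by \<open>Q\<close> as a constant and shrunk by \<open>\<beta> \<le> 1\<close>.\<close>

lemma reward_iterates_sandwich:
  fixes Q :: "(real \<Rightarrow> real) \<Rightarrow> real \<Rightarrow> real"
  assumes Q: "averaging Q" and \<beta>: "0 \<le> \<beta>" "\<beta> \<le> 1" and \<epsilon>: "0 \<le> \<epsilon>"
    and f: "\<And>z. max (g z) 0 \<le> f z"
    and step: "\<And>\<phi> z. \<lbrakk>a \<le> z; \<And>z. max (g z) 0 \<le> \<phi> z\<rbrakk> \<Longrightarrow> g z \<le> \<beta> * Q \<phi> z + \<epsilon>"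
  defines "B \<equiv> \<lambda>f x. max (\<beta> * Q f x) (g x)"
  shows "a \<le> z \<Longrightarrow> \<beta> ^ j * (Q ^^ j) f z \<le> (B ^^ j) f z"
    and "a \<le> z \<Longrightarrow> (B ^^ j) f z \<le> \<beta> ^ j * (Q ^^ j) f z + real j * \<epsilon>"
proof -
  \<comment> \<open>The bounds are carried for all \<open>z \<ge> a\<close> because \<open>Q\<close>
    at \<open>z\<close> sees the values to its right. Domination of \<open>max (g z) 0\<close> on
    the whole line makes \<open>step\<close> applicable to every iterate.\<close>
  have "(\<forall>z. max (g z) 0 \<le> (B ^^ j) f z) \<and>
    (\<forall>z\<ge>a. \<beta> ^ j * (Q ^^ j) f z \<le> (B ^^ j) f z \<and>
      (B ^^ j) f z \<le> \<beta> ^ j * (Q ^^ j) f z + real j * \<epsilon>)"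
  proof (induction j)
    case 0
    then show ?case using f by auto
  next
    case (Suc j)
    let ?\<phi> = "(B ^^ j) f" and ?\<psi> = "(Q ^^ j) f"
    have \<phi>: "\<And>z. max (g z) 0 \<le> ?\<phi> z" using Suc.IH by blast
    have BS: "(B ^^ Suc j) f z = max (\<beta> * Q ?\<phi> z) (g z)" for z
      by (simp add: B_def)
    have "0 \<le> Q ?\<phi> z" for z
    proof -
      have "Q (\<lambda>z. 0) z \<le> Q ?\<phi> z"
        using averaging_mono[OF Q, of z "\<lambda>z. 0" ?\<phi>] \<phi> by fastforce
      then show ?thesis by (simp add: averaging_const[OF Q])
    qed
    then have 1: "max (g z) 0 \<le> (B ^^ Suc j) f z" for z
      using mult_nonneg_nonneg[OF \<beta>(1), of "Q ?\<phi> z"] unfolding BS by auto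
    have 2: "\<beta> ^ Suc j * (Q ^^ Suc j) f z \<le> (B ^^ Suc j) f z" if z: "a \<le> z" for z
    proof -
      \<comment> \<open>The summand \<open>0\<close> gives the function the shape required by
        \<open>averaging_affine\<close>.\<close>
      have "Q (\<lambda>z. \<beta> ^ j * ?\<psi> z + 0) z \<le> Q ?\<phi> z"
        using Suc.IH z by (intro averaging_mono[OF Q]) auto
      then have "\<beta> ^ j * Q ?\<psi> z \<le> Q ?\<phi> z"
        by (simp only: averaging_affine[OF Q])
      from mult_left_mono[OF this \<beta>(1)] show ?thesis
        unfolding BS by (simp add: mult.assoc le_max_iff_disj)
    qed
    have 3: "(B ^^ Suc j) f z \<le> \<beta> ^ Suc j * (Q ^^ Suc j) f z + real (Suc j) * \<epsilon>"
      if z: "a \<le> z" for z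
    proof -
      have "Q ?\<phi> z \<le> Q (\<lambda>z. \<beta> ^ j * ?\<psi> z + real j * \<epsilon>) z"
        using Suc.IH z by (intro averaging_mono[OF Q]) auto
      then have "Q ?\<phi> z \<le> \<beta> ^ j * Q ?\<psi> z + real j * \<epsilon>"
        by (simp only: averaging_affine[OF Q])
      from mult_left_mono[OF this \<beta>(1)]
      have "\<beta> * Q ?\<phi> z \<le> \<beta> ^ Suc j * (Q ^^ Suc j) f z + \<beta> * (real j * \<epsilon>)"
        by (simp add: algebra_simps)
      also have "\<beta> * (real j * \<epsilon>) \<le> real j * \<epsilon>"
        using \<beta> \<epsilon> by (intro mult_left_le_one_le) auto
      finally have "\<beta> * Q ?\<phi> z \<le> \<beta> ^ Suc j * (Q ^^ Suc j) f z + real j * \<epsilon>" by simp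
      moreover have "g z \<le> \<beta> * Q ?\<phi> z + \<epsilon>" by (rule step[OF z \<phi>])
      ultimately show ?thesis using \<epsilon> unfolding BS by (simp add: algebra_simps)
    qed
    show ?case using 1 2 3 by blast
  qed
  then show "a \<le> z \<Longrightarrow> \<beta> ^ j * (Q ^^ j) f z \<le> (B ^^ j) f z"
    "a \<le> z \<Longrightarrow> (B ^^ j) f z \<le> \<beta> ^ j * (Q ^^ j) f z + real j * \<epsilon>" by blast+
qed

section \<open>Norm estimate and monotonicity of the bound in its constant\<close>

lemma L1_norm_on_le_interval:
  fixes u :: "real \<Rightarrow> real"
  assumes "0 \<le> c" "a \<le> b"
    and bound: "\<And>x. x \<in> C \<Longrightarrow> \<bar>u x\<bar> \<le> c"
    and supp: "\<And>x. x \<in> C \<Longrightarrow> u x \<noteq> 0 \<Longrightarrow> x \<in> {a..b}"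
  shows "L1_norm_on C u \<le> ereal (c * (b - a))"
proof -
  have "(\<integral>\<^sup>+x\<in>C. ennreal \<bar>u x\<bar> \<partial>lborel) \<le> (\<integral>\<^sup>+x. ennreal c * indicator {a..b} x \<partial>lborel)"
    using bound supp
    by (intro nn_integral_mono) (force split: split_indicator intro: ennreal_leI)
  also have "\<dots> = ennreal (c * (b - a))"
    using assms(1,2) by (simp add: nn_integral_cmult ennreal_mult)
  finally have "L1_norm_on C u \<le> enn2ereal (ennreal (c * (b - a)))"
    unfolding L1_norm_on_def by (simp add: less_eq_ennreal.rep_eq)
  then show ?thesis using assms(1,2) by (simp add: enn2ereal_ennreal)
qed

text \<open>This serves to replace the explicit constant, which may be zero, by a strictly positive
  one.\<close>

lemma refinement_bound_mono:
  assumes "refinement_bound P h T r g D" "D \<le> D'" "0 \<le> D'"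
  shows "refinement_bound P h T r g D'"
proof -
  have "D * s\<^sup>2 * (1 / 2 ^ M) * (1 - 1 / 2 ^ (N - M)) \<le> D' * s\<^sup>2 * (1 / 2 ^ M) * (1 - 1 / 2 ^ (N - M))"
    for s and M N :: nat
    using assms(2) by (intro mult_right_mono) auto
  moreover have "D' * s\<^sup>2 * (1 / 2 ^ M) * (1 - 1 / 2 ^ (N - M)) \<le> D' * s\<^sup>2 * (1 / 2 ^ M)"
    for s and M N :: nat
    using assms(3) by (intro mult_right_le_one_le) auto
  ultimately show ?thesis
    using assms(1) unfolding refinement_bound_def
    by (meson ereal_less_eq(3) order_trans)
qed

section \<open>The exponential as an eigenfunction\<close>

text \<open>Translation multiplies \<open>exp\<close> by a constant, so one step has eigenvalue
  \<open>c\<close>, the mean of \<open>exp (y i)\<close>. Taking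
  \<open>\<gamma> = c powr (1 / h)\<close> turns \<open>c ^ n\<close> into a power with exponent the
  time \<open>n * h\<close>.\<close>

lemma finite_state_chain_exp:
  fixes \<alpha> y :: "nat \<Rightarrow> real"
  assumes chain: "finite_state_chain h m \<alpha> y P" and "0 < h" "1 \<le> m"
  shows "\<exists>\<gamma>>0. \<forall>t\<in>time_grid h. P t exp = (\<lambda>x. \<gamma> powr t * exp x)"
proof -
  define c where "c = (\<Sum>i=1..m. \<alpha> i * exp (y i))"
  have c: "0 < c"
    unfolding c_def using chain \<open>1 \<le> m\<close>
    by (intro sum_pos) (auto simp: finite_state_chain_def)
  have Ph: "P h (\<lambda>x. a * exp x) = (\<lambda>x. c * a * exp x)" for a
    using chain unfolding finite_state_chain_def c_def
    by (auto simp: exp_add sum_distrib_left sum_distrib_right ac_simps)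
  have "(P h ^^ n) exp = (\<lambda>x. c ^ n * exp x)" for n
    by (induction n) (simp_all add: Ph)
  moreover have "(c powr (1 / h)) powr (real n * h) = c ^ n" for n
    using \<open>0 < h\<close> c by (simp add: powr_powr powr_realpow)
  ultimately have "\<forall>t\<in>time_grid h. P t exp = (\<lambda>x. (c powr (1 / h)) powr t * exp x)"
    using chain unfolding finite_state_chain_def time_grid_def by auto
  then show ?thesis using c by (intro exI[of _ "c powr (1 / h)"]) auto
qed

section \<open>The put payoff\<close>

lemma refinement_bound_put:
  fixes \<alpha> y :: "nat \<Rightarrow> real" and h T r K \<gamma> :: real
    and P :: "real \<Rightarrow> (real \<Rightarrow> real) \<Rightarrow> real \<Rightarrow> real"
  assumes h: "0 < h" and hT: "h \<le> T" and r: "0 < r" and K: "0 \<le> K" and m: "1 \<le> m"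
    and chain: "finite_state_chain h m \<alpha> y P"
    and g: "g = (\<lambda>x. K - exp x)"
    and \<gamma>: "0 < \<gamma>" "\<gamma> \<le> exp r"
    and eigen: "\<And>t. t \<in> time_grid h \<Longrightarrow> P t exp = (\<lambda>x. \<gamma> powr t * exp x)"
    and y: "\<And>i. i \<in> {1..m} \<Longrightarrow> 0 \<le> y i"
  defines "D \<equiv> ((ln \<gamma> - r) * D_tilde P h T r g exp \<gamma> + r * K + C_zero P h T r K g exp \<gamma>)
              * (Max (y ` {1..m}) / h)"
  shows "0 \<le> D" and "refinement_bound P h T r g D"
proof -
  define S where "S = {0<..T} \<inter> time_grid h"
  \<comment> \<open>The discounted eigenvalue: discounting \<open>P t exp\<close> gives
    \<open>q t\<close> times \<open>exp\<close>.\<close>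
  define q where "q t = \<gamma> powr t * exp (- r * t)" for t
  define S1 where "S1 = (SUP s\<in>S. (1 - exp (- r * s)) / s)"
  define S2 where "S2 = (SUP s\<in>S. (q s - 1) / s)"
  define \<delta> where "\<delta> = D_tilde P h T r g exp \<gamma>"
  \<comment> \<open>What remains of the first factor of \<open>D\<close> once the terms with
    \<open>r\<close> and \<open>ln \<gamma>\<close> cancel against those in
    \<open>C_zero\<close>.\<close>
  define A where "A = K * S1 + \<delta> * S2"
  define Y where "Y = Max (y ` {1..m})"
  have D: "D = A * (Y / h)"
    unfolding D_def C_zero_def A_def S1_def S2_def \<delta>_def Y_def S_def q_def
    by (simp add: algebra_simps)

  have Y: "y i \<le> Y" if "i \<in> {1..m}" for i
    unfolding Y_def using that by (intro Max_ge) auto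
  then have Y0: "0 \<le> Y" using y[of 1] Y[of 1] m by force
  have \<alpha>: "\<And>i. i \<in> {1..m} \<Longrightarrow> 0 \<le> \<alpha> i" "(\<Sum>i=1..m. \<alpha> i) = 1"
    and Ph: "\<And>f x. P h f x = (\<Sum>i=1..m. \<alpha> i * f (x + y i))"
    and Pn: "\<And>n. P (real n * h) = P h ^^ n"
    using chain unfolding finite_state_chain_def by (auto intro: less_imp_le)
  have "P h = (\<lambda>f x. \<Sum>i=1..m. \<alpha> i * f (x + y i))" using Ph by (intro ext)
  then have avg_h: "averaging (P h)"
    using averaging_weighted_translates[of "{1..m}" \<alpha> y] \<alpha> y by simp
  then have avg: "averaging (P t)" if "t \<in> time_grid h" for t
    using that Pn averaging_funpow by (auto simp: time_grid_def)
  have h_grid: "h \<in> time_grid h"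
    unfolding time_grid_def by (rule range_eqI[of _ _ 1]) simp
  then have hS: "h \<in> S" using h hT by (simp add: S_def)
  have Pg: "P t g x = K - \<gamma> powr t * exp x" if "t \<in> time_grid h" for t x
    using averaging_affine[OF avg[OF that], of "-1" exp K x] eigen[OF that]
    by (simp add: g)

  have q1: "q t \<le> 1" if "0 < t" for t
  proof -
    have "\<gamma> powr t \<le> exp r powr t" using \<gamma> that by (intro powr_mono2) auto
    then have "\<gamma> powr t \<le> exp (r * t)" by (simp add: powr_def mult.commute)
    then have "\<gamma> powr t * exp (- r * t) \<le> exp (r * t) * exp (- r * t)"
      by (intro mult_right_mono) auto
    then show ?thesis by (simp add: q_def flip: exp_add)
  qed
  have qh: "exp (- r * h) \<le> q h"
  proof -
    \<comment> \<open>Since \<open>exp\<close> is at least \<open>1\<close> on \<open>{0..}\<close>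
      and equals \<open>1\<close> at \<open>0\<close>, evaluation there yields
      \<open>\<gamma> powr h \<ge> 1\<close>.\<close>
    have "P h (\<lambda>z. 1) 0 \<le> P h exp 0" by (rule averaging_mono[OF avg_h]) auto
    then have "1 \<le> \<gamma> powr h" using eigen[OF h_grid] by (simp add: averaging_const[OF avg_h])
    then show ?thesis by (simp add: q_def)
  qed

  have S1: "1 - exp (- r * t) \<le> t * S1" if "t \<in> S" for t
  proof -
    \<comment> \<open>Boundedness above makes the real supremum dominate its members; below,
      \<open>0\<close> plays the same part for \<open>S2\<close>.\<close>
    have "(1 - exp (- r * s)) / s \<le> r" if "s \<in> S" for s
      using that exp_ge_add_one_self[of "- r * s"] by (simp add: S_def field_simps)
    then have "(1 - exp (- r * t)) / t \<le> S1"
      unfolding S1_def using that by (intro cSUP_upper bdd_aboveI2)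
    then show ?thesis using that by (simp add: S_def field_simps)
  qed
  have S2: "q t - 1 \<le> t * S2" if "t \<in> S" for t
  proof -
    have "(q s - 1) / s \<le> 0" if "s \<in> S" for s
      using that q1[of s] by (simp add: S_def divide_nonpos_pos)
    then have "(q t - 1) / t \<le> S2"
      unfolding S2_def using that by (intro cSUP_upper bdd_aboveI2)
    then show ?thesis using that by (simp add: S_def field_simps)
  qed

  \<comment> \<open>Location of E^h and size of \<open>\<delta>\<close>\<close>
  have E_if: "x \<in> E_set P g h" if "K < exp x" for x
  proof -
    \<comment> \<open>On \<open>{x..}\<close> the payoff is at most the negative constant
      \<open>K - exp x\<close>, so its mean is negative, unlike that of its positive part.\<close>
    have "P h (\<lambda>z. 0) x \<le> P h (\<lambda>z. max (g z) 0) x"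
      by (rule averaging_mono[OF avg_h]) auto
    moreover have "P h g x \<le> P h (\<lambda>z. K - exp x) x"
      by (rule averaging_mono[OF avg_h]) (simp add: g)
    ultimately show ?thesis
      using that by (simp add: E_set_def averaging_const[OF avg_h])
  qed
  have E_only: "K < exp (x + Y)" if "x \<in> E_set P g h" for x
  proof (rule ccontr)
    assume *: "\<not> K < exp (x + Y)"
    \<comment> \<open>If even the largest increment stays within \<open>g \<ge> 0\<close>, then
      \<open>g\<close> agrees with its positive part at every point reached.\<close>
    have "exp (x + y i) \<le> K" if "i \<in> {1..m}" for i
    proof -
      have "exp (x + y i) \<le> exp (x + Y)" using Y[OF that] by simp
      then show ?thesis using * by linarith
    qed
    then have "P h (\<lambda>z. max (g z) 0) x = P h g x"
      unfolding Ph by (intro sum.cong) (auto simp: g)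
    then show False using that by (simp add: E_set_def)
  qed

  have \<delta>_le: "\<delta> \<le> exp x" if "x \<in> E_set P g h" for x
  proof (cases "\<gamma> = exp r")
    case True
    then show ?thesis by (simp add: \<delta>_def D_tilde_def)
  next
    case False
    then have "\<delta> = (INF x\<in>(\<Union>t\<in>S. E_set P g t). exp x)"
      using \<gamma> by (simp add: \<delta>_def D_tilde_def S_def)
    \<comment> \<open>E^h is a member of the union because \<open>h \<le> T\<close>.\<close>
    also have "\<dots> \<le> exp x"
      using that hS by (intro cINF_lower bdd_belowI2[of _ 0]) auto
    finally show ?thesis .
  qed
  have \<delta>_ge: "0 \<le> \<delta>"
  proof (cases "\<gamma> = exp r")
    case True
    then show ?thesis by (simp add: \<delta>_def D_tilde_def)
  next
    case False
    then have \<delta>: "\<delta> = (INF x\<in>(\<Union>t\<in>S. E_set P g t). exp x)"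
      using \<gamma> by (simp add: \<delta>_def D_tilde_def S_def)
    \<comment> \<open>This point shows that the infimum is over a nonempty set.\<close>
    have "ln (K + 1) \<in> E_set P g h" using K by (intro E_if) simp
    then show ?thesis unfolding \<delta> using hS by (intro cINF_greatest) auto
  qed
  have \<delta>_K: "\<delta> \<le> K"
  proof (rule field_le_epsilon)
    fix e :: real assume "0 < e"
    \<comment> \<open>E^h contains points where \<open>exp\<close> exceeds \<open>K\<close> by an
      arbitrarily small amount.\<close>
    then show "\<delta> \<le> K + e" using \<delta>_le[OF E_if, of "ln (K + e)"] K by simp
  qed

  have tA: "K * (1 - exp (- r * t)) - \<delta> * (1 - q t) \<le> t * A" if "t \<in> S" for t
    using mult_left_mono[OF S1[OF that] K] mult_left_mono[OF S2[OF that] \<delta>_ge]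
    by (simp add: A_def algebra_simps)
  have A: "0 \<le> A"
  proof -
    \<comment> \<open>Both factors are compared: \<open>\<delta>_K\<close> for the first,
      \<open>qh\<close> for the second. The one-step estimate at \<open>t = h\<close> then fixes the
      sign of \<open>A\<close>.\<close>
    have "\<delta> * (1 - q h) \<le> K * (1 - exp (- r * h))"
      using \<delta>_K K qh q1[OF h] by (intro mult_mono) auto
    then have "0 \<le> h * A" using tA[OF hS] by linarith
    then show ?thesis using h by (simp add: zero_le_mult_iff)
  qed
  show "0 \<le> D" unfolding D using A Y0 h by simp

  \<comment> \<open>Iterates with a fixed step size\<close>
  have B: "B_op P r g t = (\<lambda>f x. max (exp (- r * t) * P t f x) (g x))" for t
    by (intro ext) (simp add: B_op_def)
  \<comment> \<open>By the semigroup law the sandwich depends on \<open>j\<close> and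
    \<open>t\<close> only through \<open>j * t\<close>, so refinements of the same total time share
    both ends.\<close>
  have iter: "exp (- r * t) ^ j * (P t ^^ j) f x = exp (- r * (real j * t)) * P (real j * t) f x"
    if grid: "t \<in> time_grid h" for t j f x
  proof -
    obtain n where t: "t = real n * h" using grid unfolding time_grid_def by auto
    have "P (real j * t) = P t ^^ j"
      unfolding t Pn funpow_mult using Pn[of "n * j"] by (simp add: mult_ac)
    moreover have "exp (- r * t) ^ j = exp (- r * (real j * t))"
      using exp_of_nat_mult[of j "- r * t"] by (simp add: mult.left_commute)
    ultimately show ?thesis by simp
  qed
  have between: "exp (- r * (real j * t)) * P (real j * t) f x \<le> (B_op P r g t ^^ j) f x"
      "(B_op P r g t ^^ j) f x
         \<le> exp (- r * (real j * t)) * P (real j * t) f x + real j * t * A"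
    if t: "t \<in> S" and x: "x \<in> E_set P g h" and f: "\<And>x. max (g x) 0 \<le> f x" for t j f x
  proof -
    have t': "t \<in> time_grid h" "0 < t" using t by (auto simp: S_def)
    have step: "g z \<le> exp (- r * t) * P t \<phi> z + t * A"
      if z: "x \<le> z" and \<phi>: "\<And>z. max (g z) 0 \<le> \<phi> z" for \<phi> z
    proof -
      have "P t g z \<le> P t \<phi> z" using \<phi> by (intro averaging_mono[OF avg[OF t'(1)]]) auto
      then have "exp (- r * t) * P t g z \<le> exp (- r * t) * P t \<phi> z" by simp
      then have "K * exp (- r * t) - q t * exp z \<le> exp (- r * t) * P t \<phi> z"
        by (simp add: Pg[OF t'(1)] q_def algebra_simps)
      \<comment> \<open>The bound at \<open>x\<close> passes to every \<open>z\<close> to the right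
        since \<open>exp\<close> increases.\<close>
      moreover have "\<delta> \<le> exp z" using \<delta>_le[OF x] z by (meson exp_le_cancel_iff order_trans)
      then have "\<delta> * (1 - q t) \<le> exp z * (1 - q t)"
        using q1[OF t'(2)] by (intro mult_right_mono) auto
      ultimately show ?thesis using tA[OF t] by (simp add: g algebra_simps)
    qed
    note sandwich = reward_iterates_sandwich[where g = g and Q = "P t" and a = x and z = x
        and \<beta> = "exp (- r * t)" and \<epsilon> = "t * A" and f = f and j = j, OF avg[OF t'(1)] _ _ _ f step]
    show "exp (- r * (real j * t)) * P (real j * t) f x \<le> (B_op P r g t ^^ j) f x"
      "(B_op P r g t ^^ j) f x
         \<le> exp (- r * (real j * t)) * P (real j * t) f x + real j * t * A"
      using sandwich A r t'(2) unfolding B iter[OF t'(1), symmetric] by (simp_all add: mult.assoc)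
  qed
  \<comment> \<open>From \<open>x\<close> on the payoff is at most zero and continuation is
    nonnegative, so the sandwich holds with error \<open>0\<close>.\<close>
  have exact: "(B_op P r g t ^^ j) f x = exp (- r * (real j * t)) * P (real j * t) f x"
    if t: "t \<in> S" and x: "K \<le> exp x" and f: "\<And>x. max (g x) 0 \<le> f x" for t j f x
  proof -
    have t': "t \<in> time_grid h" "0 < t" using t by (auto simp: S_def)
    have step: "g z \<le> exp (- r * t) * P t \<phi> z + 0"
      if z: "x \<le> z" and \<phi>: "\<And>z. max (g z) 0 \<le> \<phi> z" for \<phi> z
    proof -
      have "P t (\<lambda>z. 0) z \<le> P t \<phi> z" using \<phi> by (intro averaging_mono[OF avg[OF t'(1)]]) auto
      then have "0 \<le> P t \<phi> z" by (simp add: averaging_const[OF avg[OF t'(1)]])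
      moreover have "K \<le> exp z" using x z by (meson exp_le_cancel_iff order_trans)
      ultimately show ?thesis by (simp add: g) (meson exp_ge_zero le_iff_diff_le_0 mult_nonneg_nonneg order_trans)
    qed
    note sandwich = reward_iterates_sandwich[where g = g and Q = "P t" and a = x and z = x
        and \<beta> = "exp (- r * t)" and \<epsilon> = 0 and f = f and j = j, OF avg[OF t'(1)] _ _ _ f step]
    show ?thesis
      using sandwich r t'(2) unfolding B iter[OF t'(1), symmetric] by (simp add: order_antisym)
  qed

  \<comment> \<open>Comparison of two refinement levels\<close>
  show "refinement_bound P h T r g D"
    unfolding refinement_bound_def
  proof (intro allI impI conjI)
    fix M N :: nat and s f
    assume MN: "M < N" and s: "s \<in> {0<..T} \<inter> (\<lambda>t. 2 ^ N * t) ` time_grid h"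
      and f: "\<forall>x. max (g x) 0 \<le> f x"
    obtain n where n: "s = 2 ^ N * (real n * h)" using s unfolding time_grid_def by auto
    have s0: "0 < s" "s \<le> T" using s by auto
    then have n1: "1 \<le> n" using n h by (cases n) auto
    have tS: "s / 2 ^ i \<in> S" if "i \<le> N" for i
    proof -
      \<comment> \<open>Divisibility of \<open>s\<close> by \<open>2 ^ N\<close> on the grid keeps
        all coarser step sizes on the grid.\<close>
      have "s / 2 ^ i = real (2 ^ (N - i) * n) * h"
        using that by (simp add: n power_diff[of "2::real"])
      then have "s / 2 ^ i \<in> time_grid h" unfolding time_grid_def by blast
      moreover have "s / 2 ^ i \<le> s / 1" using s0 by (intro divide_left_mono) auto
      ultimately show ?thesis using s0 by (simp add: S_def)
    qed
    let ?B = "\<lambda>i. (B_op P r g (s / 2 ^ i)) ^^ (2 ^ i)"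
    have "\<bar>?B N f x - ?B M f x\<bar> \<le> s * A" if "x \<in> E_set P g h" for x
      using between[OF tS[of N] that, of f "2 ^ N"] between[OF tS[of M] that, of f "2 ^ M"] f MN
      by (simp add: abs_le_iff)
    moreover have "x \<in> {ln K - Y..ln K}"
      if x: "x \<in> E_set P g h" and ne: "?B N f x - ?B M f x \<noteq> 0" for x
    proof -
      have "\<not> K \<le> exp x"
        using exact[OF tS[of N], of x f "2 ^ N"] exact[OF tS[of M], of x f "2 ^ M"] f MN ne by auto
      then have *: "exp x < K" by simp
      \<comment> \<open>For \<open>K = 0\<close> the levels never differ, so the value of
        \<open>ln K\<close> is then harmless.\<close>
      then have "0 < K" by (meson exp_gt_zero order.strict_trans)
      then have "x < ln K" "ln K < x + Y" using * E_only[OF x] by (metis exp_less_cancel_iff exp_ln)+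
      then show ?thesis by auto
    qed
    ultimately have "L1_norm_on (E_set P g h) (\<lambda>x. ?B N f x - ?B M f x)
        \<le> ereal (s * A * (ln K - (ln K - Y)))"
      using A s0 Y0 by (intro L1_norm_on_le_interval) auto
    also have "s * A * (ln K - (ln K - Y)) \<le> D * s\<^sup>2 * (1 / 2 ^ M) * (1 - 1 / 2 ^ (N - M))"
    proof -
      have "(2::real) ^ 1 \<le> 2 ^ (N - M)" using MN by (intro power_increasing) auto
      then have "1 * 1 \<le> real n * (2 ^ (N - M) - 1)" using n1 by (intro mult_mono) auto
      then have "h * 1 \<le> h * (real n * (2 ^ (N - M) - 1))" using h by (intro mult_left_mono) auto
      \<comment> \<open>Both sides equal \<open>s / 2 ^ M - s / 2 ^ N\<close>, the gap between the
        two step sizes.\<close>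
      also have "\<dots> = s * (1 / 2 ^ M) * (1 - 1 / 2 ^ (N - M))"
        using MN by (simp add: n power_diff field_simps)
      \<comment> \<open>Writing \<open>s * A * Y\<close> with a factor \<open>h\<close> and
        enlarging it to this gap supplies the second power of \<open>s\<close> and the decay in
        \<open>M\<close>.\<close>
      finally have "s * A * Y / h * h \<le> s * A * Y / h * (s * (1 / 2 ^ M) * (1 - 1 / 2 ^ (N - M)))"
        using A s0 Y0 h by (intro mult_left_mono) auto
      then show ?thesis using h unfolding D by (simp add: power2_eq_square mult_ac)
    qed
    finally show "L1_norm_on (E_set P g h) (\<lambda>x. ?B N f x - ?B M f x)
        \<le> ereal (D * s\<^sup>2 * (1 / 2 ^ M) * (1 - 1 / 2 ^ (N - M)))" by simp
    show "D * s\<^sup>2 * (1 / 2 ^ M) * (1 - 1 / 2 ^ (N - M)) \<le> D * s\<^sup>2 * (1 / 2 ^ M)"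
      using \<open>0 \<le> D\<close> by (intro mult_right_le_one_le) auto
  qed
qed

theorem mainTheorem1:
  fixes h T r K :: real and m :: nat
    and \<alpha> y :: "nat \<Rightarrow> real"
    and P :: "real \<Rightarrow> (real \<Rightarrow> real) \<Rightarrow> real \<Rightarrow> real"
    and fbar g :: "real \<Rightarrow> real"
  assumes "0 < h"
    and "\<exists>k::nat. 2 \<le> k \<and> T = real k * h"
    and "0 < r" and "0 \<le> K" and "1 \<le> m"
    and "finite_state_chain h m \<alpha> y P"
    and "fbar = exp"
    and "g = (\<lambda>x. K - fbar x)"
  shows "(\<exists>\<gamma>>0. \<forall>t\<in>time_grid h. P t fbar = (\<lambda>x. \<gamma> powr t * fbar x)) \<and>
    (\<forall>\<gamma>. 0 < \<gamma> \<longrightarrow> (\<forall>t\<in>time_grid h. P t fbar = (\<lambda>x. \<gamma> powr t * fbar x)) \<longrightarrow>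
       \<gamma> \<le> exp r \<longrightarrow> (\<forall>i\<in>{1..m}. y i \<ge> 0) \<longrightarrow>
         (\<exists>D>0. refinement_bound P h T r g D) \<and>
         refinement_bound P h T r g
           (((ln \<gamma> - r) * D_tilde P h T r g fbar \<gamma> + r * K + C_zero P h T r K g fbar \<gamma>)
              * (Max (y ` {1..m}) / h)))"
proof (intro conjI allI impI)
  show "\<exists>\<gamma>>0. \<forall>t\<in>time_grid h. P t fbar = (\<lambda>x. \<gamma> powr t * fbar x)"
    using finite_state_chain_exp[OF assms(6,1,5)] assms(7) by simp
next
  fix \<gamma> :: real
  let ?D = "((ln \<gamma> - r) * D_tilde P h T r g fbar \<gamma> + r * K + C_zero P h T r K g fbar \<gamma>)
              * (Max (y ` {1..m}) / h)"
  assume "0 < \<gamma>" "\<forall>t\<in>time_grid h. P t fbar = (\<lambda>x. \<gamma> powr t * fbar x)"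
    "\<gamma> \<le> exp r" "\<forall>i\<in>{1..m}. y i \<ge> 0"
  moreover have "h \<le> T"
  proof -
    obtain k :: nat where k: "2 \<le> k" "T = real k * h" using assms(2) by blast
    then have "1 * h \<le> real k * h" using assms(1) by (intro mult_right_mono) auto
    then show ?thesis using k by simp
  qed
  ultimately have "0 \<le> ?D" and bound: "refinement_bound P h T r g ?D"
    using refinement_bound_put[of h T r K m \<alpha> y P g \<gamma>] assms by auto
  \<comment> \<open>Adding \<open>1\<close> ensures strict positivity: \<open>?D\<close> vanishes,
    for instance, when all increments are zero.\<close>
  then show "\<exists>D>0. refinement_bound P h T r g D"
    using refinement_bound_mono[OF bound, of "?D + 1"] by (intro exI[of _ "?D + 1"]) auto
  show "refinement_bound P h T r g ?D" by (rule bound)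
qed

end
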